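(* Let $f=f_c+f_d:\mathbb{R}^d\to\mathbb{R}\cup\{+\infty\}$ and $g=g_c+g_d:\mathbb{R}^m\to\mathbb{R}\cup\{+\infty\}$, where $f_c,g_c$ are convex, proper and lower semicontinuous and $f_d:\mathbb{R}^d\to\mathbb{R}$, $g_d:\mathbb{R}^m\to\mathbb{R}$ are twice differentiable (possibly nonconvex). Let $A\in\mathbb{R}^{k\times d}$, $B\in\mathbb{R}^{k\times m}$, $c\in\mathbb{R}^k$, and let $\Sigma\in\mathbb{R}^{k\times k}$ be symmetric positive definite. Let $\varepsilon,\varepsilon_{\mathrm{FOSP}},\alpha_f,\alpha_g\ge 0$ and $c_f,c_g\in(0,+\infty]$. Let $(\tilde x,\tilde y)$ be feasible, i.e. $\tilde x\in\mathrm{dom}(f)$, $\tilde y\in\mathrm{dom}(g)$, $A\tilde x+B\tilde y=c$. Suppose there exist subgradients $\xi_{\tilde x}\in\partial f(\tilde x)$, $\zeta_{\tilde y}\in\partial g(\tilde y)$ and a vector $\tilde u\in\mathbb{R}^k$ such that: (1) (Restricted strong convexity) for all $x\in\mathrm{dom}(f)$, $y\in\mathrm{dom}(g)$, $\xi_x\in\partial f(x)$, $\zeta_y\in\partial g(y)$, $$\langle x-\tilde x,\xi_x-\xi_{\tilde x}\rangle+\langle y-\tilde y,\zeta_y-\zeta_{\tilde y}\rangle\ \ge\ \alpha_f\min\{\|x-\tilde x\|_2^2,\,c_f\|x-\tilde x\|_2\}+\alpha_g\min\{\|y-\tilde y\|_2^2,\,c_g\|y-\tilde y\|_2\}-\tfrac12\|Ax+By-c\|_\Sigma^2-\varepsilon^2;$$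 (2) (Approximate first-order optimality) $$\|-A^\top\tilde u-\xi_{\tilde x}\|_2\le\min\Big\{\tfrac{\alpha_fc_f}{2},\sqrt{\alpha_f}\,\varepsilon_{\mathrm{FOSP}}\Big\},\qquad \|-B^\top\tilde u-\zeta_{\tilde y}\|_2\le\min\Big\{\tfrac{\alpha_gc_g}{2},\sqrt{\alpha_g}\,\varepsilon_{\mathrm{FOSP}}\Big\}.$$ Let $H_f\in\mathbb{R}^{d\times d}$, $H_g\in\mathbb{R}^{m\times m}$ be symmetric matrices with $H_f\succeq0$, $H_f+A^\top\Sigma A\succ0$, $H_f\succeq\nabla^2f_d(x)$ for all $x\in\mathrm{dom}(f)$, and $H_g\succeq0$, $H_g+B^\top\Sigma B\succ0$, $H_g\succeq\nabla^2g_d(y)$ for all $y\in\mathrm{dom}(g)$. Let $(x_0,y_0,u_0)\in\mathrm{dom}(f)\times\mathrm{dom}(g)\times\mathbb{R}^k$ be arbitrary, and for $t=0,1,2,\dots$ define (ADMM with linear approximations) $$x_{t+1}=\arg\min_x\Big\{f_c(x)+\langle x,\nabla f_d(x_t)+A^\top u_t\rangle+\tfrac12\|Ax+By_t-c\|_\Sigma^2+\tfrac12\|x-x_t\|_{H_f}^2\Big\},$$ $$y_{t+1}=\arg\min_y\Big\{g_c(y)+\langle y,\nabla g_d(y_t)+B^\top u_t\rangle+\tfrac12\|Ax_{t+1}+By-c\|_\Sigma^2+\tfrac12\|y-y_t\|_{H_g}^2\Big\},$$ $$u_{t+1}=u_t+\Sigma(Ax_{t+1}+By_{t+1}-c).$$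 Let $\bar x_T=\frac1T\sum_{t=1}^Tx_t$ and $\bar y_T=\frac1T\sum_{t=1}^Ty_t$. Then for all $T\ge1$, $$\alpha_f\min\{\|\bar x_T-\tilde x\|_2^2,\,c_f\|\bar x_T-\tilde x\|_2\}+\alpha_g\min\{\|\bar y_T-\tilde y\|_2^2,\,c_g\|\bar y_T-\tilde y\|_2\}\ \le\ \frac{C(\tilde x,\tilde y,\tilde u;x_0,y_0,u_0)}{T}+4(\varepsilon^2+\varepsilon_{\mathrm{FOSP}}^2),$$ where $C(\tilde x,\tilde y,\tilde u;x_0,y_0,u_0)$, given explicitly in the context, does not depend on $T$.
   Context: Notation: $\mathrm{dom}(f)=\{x:f(x)<+\infty\}=\mathrm{dom}(f_c)$, and similarly for $g$. For a positive semidefinite matrix $H$, $\|v\|_H^2=v^\top Hv$. $\succeq,\succ$ denote the positive semidefinite/definite order. Subdifferential: for $x\in\mathrm{dom}(f)$, $\partial f(x)=\{\xi:\lim_{t\downarrow0}\frac{f(x+tw)-f(x)}{t}\ge\langle\xi,w\rangle\ \forall w\in\mathbb{R}^d\}$; equivalently $\partial f(x)=\{\xi+\nabla f_d(x):\xi\in\partial f_c(x)\}$ with $\partial f_c(x)=\{\xi:f_c(x+w)-f_c(x)\ge\langle\xi,w\rangle\ \forall w\}$ the usual convex subdifferential. Similarly for $g$. Conventions when $c_f=+\infty$: $\min\{r^2,c_fr\}$ means $r^2$, and $\min\{\alpha_fc_f/2,\sqrt{\alpha_f}\,\varepsilon_{\mathrm{FOSP}}\}$ means $\sqrt{\alpha_f}\,\varepsilon_{\mathrm{FOSP}}$;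 similarly for $c_g$. The constant: let $x_1$ be the first $x$-iterate (a deterministic function of $(x_0,y_0,u_0)$), let $$M=\begin{pmatrix} H_f+A^\top\Sigma A & 0 & A^\top \\ 0 & H_g & 0 \\ A & 0 & \Sigma^{-1} \end{pmatrix}\succeq0,$$ $\tilde z=(\tilde x,\tilde y,\tilde u)$ and $z_0=(x_1,y_0,u_0)$. Define $$C_1=\tfrac12\|\tilde z-z_0\|_M^2-\langle\tilde x-x_1,\nabla f_d(\tilde x)-\nabla f_d(x_1)\rangle+\tfrac12\|\tilde x-x_1\|_{H_f}^2-\langle\tilde y-y_0,\nabla g_d(\tilde y)-\nabla g_d(y_0)\rangle+\tfrac12\|\tilde y-y_0\|_{H_g}^2,$$ $$C(\tilde x,\tilde y,\tilde u;x_0,y_0,u_0)=4C_1+2\alpha_f\min\{\|x_1-\tilde x\|_2^2,\,c_f\|x_1-\tilde x\|_2\}.$$ The $\arg\min$ in the $x$- and $y$-updates exist and are unique under the stated conditions on $H_f,H_g,\Sigma$. *)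

theory Defs
  imports "HOL-Analysis.Analysis"
begin

definition eff_dom :: "('a \<Rightarrow> ereal) \<Rightarrow> 'a set" where
  "eff_dom f = {x. f x < \<infinity>}"

definition proper_fun :: "('a \<Rightarrow> ereal) \<Rightarrow> bool" where
  "proper_fun f \<longleftrightarrow> (\<forall>x. f x \<noteq> -\<infinity>) \<and> (\<exists>x. f x < \<infinity>)"

definition lsc_fun :: "('a::topological_space \<Rightarrow> ereal) \<Rightarrow> bool" where
  "lsc_fun f \<longleftrightarrow> (\<forall>x. f x \<le> Liminf (at x) f)"

(* Used for proper functions only, so the undefined sum of plus and minus infinity
   does not arise; a zero coefficient is harmless because 0 * \<infinity> = 0 in ereal. *)
definition convex_fun :: "('a::real_vector \<Rightarrow> ereal) \<Rightarrow> bool" where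
  "convex_fun f \<longleftrightarrow>
     (\<forall>x y. \<forall>a\<ge>0. \<forall>b\<ge>0. a + b = 1 \<longrightarrow>
        f (a *\<^sub>R x + b *\<^sub>R y) \<le> ereal a * f x + ereal b * f y)"

(* The existence of the one-sided directional derivative, as an extended real,
   is part of membership; it is automatic for a convex function plus a
   differentiable one. *)
definition subdiff :: "('a::real_inner \<Rightarrow> ereal) \<Rightarrow> 'a \<Rightarrow> 'a set" where
  "subdiff f x = {\<xi>. x \<in> eff_dom f \<and>
     (\<forall>w. \<exists>L. ((\<lambda>t::real. (f (x + t *\<^sub>R w) - f x) / ereal t) \<longlongrightarrow> L) (at_right 0)
               \<and> ereal (\<xi> \<bullet> w) \<le> L)}"

definition grad :: "('a::real_inner \<Rightarrow> real) \<Rightarrow> 'a \<Rightarrow> 'a" where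
  "grad f x = (THE D. GDERIV f x :> D)"

definition hess :: "(real ^ 'n \<Rightarrow> real) \<Rightarrow> real ^ 'n \<Rightarrow> real ^ 'n ^ 'n" where
  "hess f x = matrix (frechet_derivative (grad f) (at x))"

definition twice_differentiable :: "(real ^ 'n \<Rightarrow> real) \<Rightarrow> bool" where
  "twice_differentiable f \<longleftrightarrow>
     (\<forall>x. f differentiable (at x)) \<and> (\<forall>x. grad f differentiable (at x))"

definition sym_mat :: "real ^ 'n ^ 'n \<Rightarrow> bool" where
  "sym_mat P \<longleftrightarrow> transpose P = P"

(* Symmetry is not built into psd and posdef; it is a separate hypothesis where needed.
   Hessians of twice differentiable functions are symmetric in any case. *)
definition psd :: "real ^ 'n ^ 'n \<Rightarrow> bool" where
  "psd P \<longleftrightarrow> (\<forall>v. 0 \<le> v \<bullet> (P *v v))"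

definition posdef :: "real ^ 'n ^ 'n \<Rightarrow> bool" where
  "posdef P \<longleftrightarrow> (\<forall>v. v \<noteq> 0 \<longrightarrow> 0 < v \<bullet> (P *v v))"

definition wnorm_sq :: "real ^ 'n ^ 'n \<Rightarrow> real ^ 'n \<Rightarrow> real" where
  "wnorm_sq P v = v \<bullet> (P *v v)"

text \<open>The parameter \<open>c\<close> ranges over \<open>(0, \<infinity>]\<close>.\<close>

definition min_quad_lin :: "ereal \<Rightarrow> real \<Rightarrow> real" where
  "min_quad_lin c r = (if c = \<infinity> then r\<^sup>2 else min (r\<^sup>2) (real_of_ereal c * r))"

definition fosp_tol :: "real \<Rightarrow> ereal \<Rightarrow> real \<Rightarrow> real" where
  "fosp_tol \<alpha> c e =
     (if c = \<infinity> then sqrt \<alpha> * e else min (\<alpha> * real_of_ereal c / 2) (sqrt \<alpha> * e))"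

definition admm_x ::
  "(real ^ 'd \<Rightarrow> ereal) \<Rightarrow> (real ^ 'd \<Rightarrow> real) \<Rightarrow> real ^ 'd ^ 'k \<Rightarrow> real ^ 'm ^ 'k \<Rightarrow> real ^ 'k
   \<Rightarrow> real ^ 'k ^ 'k \<Rightarrow> real ^ 'd ^ 'd \<Rightarrow> real ^ 'd \<Rightarrow> real ^ 'm \<Rightarrow> real ^ 'k \<Rightarrow> real ^ 'd" where
  "admm_x fc fd A B c S Hf x y u =
     arg_min (\<lambda>v. fc v + ereal (v \<bullet> (grad fd x + transpose A *v u)
                              + 1/2 * wnorm_sq S (A *v v + B *v y - c)
                              + 1/2 * wnorm_sq Hf (v - x)))
             (\<lambda>_. True)"

text \<open>Here the argument \<open>x\<close> is the already updated first block.\<close>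

definition admm_y ::
  "(real ^ 'm \<Rightarrow> ereal) \<Rightarrow> (real ^ 'm \<Rightarrow> real) \<Rightarrow> real ^ 'd ^ 'k \<Rightarrow> real ^ 'm ^ 'k \<Rightarrow> real ^ 'k
   \<Rightarrow> real ^ 'k ^ 'k \<Rightarrow> real ^ 'm ^ 'm \<Rightarrow> real ^ 'd \<Rightarrow> real ^ 'm \<Rightarrow> real ^ 'k \<Rightarrow> real ^ 'm" where
  "admm_y gc gd A B c S Hg x y u =
     arg_min (\<lambda>v. gc v + ereal (v \<bullet> (grad gd y + transpose B *v u)
                              + 1/2 * wnorm_sq S (A *v x + B *v v - c)
                              + 1/2 * wnorm_sq Hg (v - y)))
             (\<lambda>_. True)"

definition join_vec :: "real ^ 'd \<Rightarrow> real ^ 'm \<Rightarrow> real ^ 'k \<Rightarrow> real ^ ('d + ('m + 'k))" where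
  "join_vec x y u =
     (\<chi> i. case i of Inl a \<Rightarrow> x $ a | Inr r \<Rightarrow> (case r of Inl b \<Rightarrow> y $ b | Inr l \<Rightarrow> u $ l))"

(* The 3x3 block matrix with rows (Hf + A^T S A, 0, A^T), (0, Hg, 0), (A, 0, S^-1). *)
definition admm_M ::
  "real ^ 'd ^ 'k \<Rightarrow> real ^ 'k ^ 'k \<Rightarrow> real ^ 'd ^ 'd \<Rightarrow> real ^ 'm ^ 'm
   \<Rightarrow> real ^ ('d + ('m + 'k)) ^ ('d + ('m + 'k))" where
  "admm_M A S Hf Hg = (\<chi> i j.
     case i of
       Inl a \<Rightarrow> (case j of
           Inl a' \<Rightarrow> (Hf + transpose A ** S ** A) $ a $ a'
         | Inr s \<Rightarrow> (case s of Inl b' \<Rightarrow> 0 | Inr l' \<Rightarrow> transpose A $ a $ l'))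
     | Inr r \<Rightarrow> (case r of
           Inl b \<Rightarrow> (case j of
               Inl a' \<Rightarrow> 0
             | Inr s \<Rightarrow> (case s of Inl b' \<Rightarrow> Hg $ b $ b' | Inr l' \<Rightarrow> 0))
         | Inr l \<Rightarrow> (case j of
               Inl a' \<Rightarrow> A $ l $ a'
             | Inr s \<Rightarrow> (case s of Inl b' \<Rightarrow> 0 | Inr l' \<Rightarrow> matrix_inv S $ l $ l'))))"

definition admm_C1 ::
  "(real ^ 'd \<Rightarrow> real) \<Rightarrow> (real ^ 'm \<Rightarrow> real) \<Rightarrow> real ^ 'd ^ 'k \<Rightarrow> real ^ 'k ^ 'k
   \<Rightarrow> real ^ 'd ^ 'd \<Rightarrow> real ^ 'm ^ 'm \<Rightarrow> real ^ 'd \<Rightarrow> real ^ 'm \<Rightarrow> real ^ 'k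
   \<Rightarrow> real ^ 'd \<Rightarrow> real ^ 'm \<Rightarrow> real ^ 'k \<Rightarrow> real" where
  "admm_C1 fd gd A S Hf Hg xt yt ut x1 y0 u0 =
     1/2 * wnorm_sq (admm_M A S Hf Hg) (join_vec xt yt ut - join_vec x1 y0 u0)
     - (xt - x1) \<bullet> (grad fd xt - grad fd x1) + 1/2 * wnorm_sq Hf (xt - x1)
     - (yt - y0) \<bullet> (grad gd yt - grad gd y0) + 1/2 * wnorm_sq Hg (yt - y0)"

definition admm_C ::
  "(real ^ 'd \<Rightarrow> ereal) \<Rightarrow> (real ^ 'd \<Rightarrow> real) \<Rightarrow> (real ^ 'm \<Rightarrow> real)
   \<Rightarrow> real ^ 'd ^ 'k \<Rightarrow> real ^ 'm ^ 'k \<Rightarrow> real ^ 'k \<Rightarrow> real ^ 'k ^ 'k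
   \<Rightarrow> real ^ 'd ^ 'd \<Rightarrow> real ^ 'm ^ 'm \<Rightarrow> real \<Rightarrow> ereal
   \<Rightarrow> real ^ 'd \<Rightarrow> real ^ 'm \<Rightarrow> real ^ 'k \<Rightarrow> real ^ 'd \<Rightarrow> real ^ 'm \<Rightarrow> real ^ 'k \<Rightarrow> real" where
  "admm_C fc fd gd A B c S Hf Hg \<alpha>f cf xt yt ut x0 y0 u0 =
     (let x1 = admm_x fc fd A B c S Hf x0 y0 u0 in
        4 * admm_C1 fd gd A S Hf Hg xt yt ut x1 y0 u0
        + 2 * \<alpha>f * min_quad_lin cf (norm (x1 - xt)))"

end

(* Put D_f(a, b) = 1/2 |a - b|^2_Hf - (f_d a - f_d b - <a - b, grad f_d b>), the Bregman divergence of
   1/2 |.|^2_Hf - f_d, which is convex on dom f because Hf dominates the Hessian of f_d; similarly D_g.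
   With p_t = A (x_(t+1) - xt) + S^-1 (u_t - ut), the potential
     V_t = 1/2 |p_t|^2_S + D_f(xt, x_(t+1)) + D_g(yt, y_t)
   satisfies, by the optimality conditions of the two updates and the three-point identity for Bregman
   divergences, an identity in which p_(t+1) - p_t = A x_(t+2) + B y_(t+1) - c contributes exactly
   the infeasibility term lost in restricted strong convexity. Young's inequality absorbs the
   first-order residuals into half of the remaining gain. Summing telescopes; V_0 is at most C_1 since
   D(a, b) + D(b, a) = |a - b|^2_H - <a - b, grad a - grad b>. The index shift in x costs the term at x_1,
   and passing to the average costs a factor 2 because min(r^2, c r) is convex only up to that factor. *)
theory Submission
  imports Defs
begin

section \<open>Gradients, weighted norms and Bregman divergences\<close>

text \<open>\<open>grad\<close> is a definite description, so the vector representing the derivative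
  must be unique as well as exist. It is assembled from the values of the derivative on
  \<open>Basis\<close>.\<close>

lemma gderiv_grad:
  fixes f :: "'a::euclidean_space \<Rightarrow> real"
  assumes "f differentiable (at x)"
  shows "GDERIV f x :> grad f x"
proof -
  obtain f' where f': "(f has_derivative f') (at x)"
    using assms by (auto simp: differentiable_def)
  then have lin: "linear f'"
    by (rule has_derivative_linear)
  define D where "D = (\<Sum>b\<in>Basis. f' b *\<^sub>R b)"
  have f'_eq: "f' h = h \<bullet> D" for h
    by (subst (1) euclidean_representation[of h, symmetric])
      (simp add: linear_sum[OF lin] linear_cmul[OF lin] D_def inner_sum_right mult.commute)
  then have D: "GDERIV f x :> D"
    using f' by (simp add: gderiv_def flip: f'_eq)
  have "D' = D" if "GDERIV f x :> D'" for D'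
  proof -
    have "(\<lambda>h. h \<bullet> D') = (\<lambda>h. h \<bullet> D)"
      using has_derivative_unique that D by (auto simp: gderiv_def)
    then have "h \<bullet> D' = h \<bullet> D" for h
      by metis
    then show ?thesis
      by (metis vector_eq_ldot)
  qed
  with D show ?thesis
    unfolding grad_def by (rule theI)
qed

definition bregman :: "real ^ 'n ^ 'n \<Rightarrow> (real ^ 'n \<Rightarrow> real) \<Rightarrow> real ^ 'n \<Rightarrow> real ^ 'n \<Rightarrow> real" where
  "bregman H f a b = 1/2 * wnorm_sq H (a - b) - (f a - f b - (a - b) \<bullet> grad f b)"

lemma sym_mat_inner: "sym_mat P \<Longrightarrow> v \<bullet> (P *v w) = w \<bullet> (P *v v)"
  by (metis dot_lmul_matrix inner_commute sym_mat_def transpose_matrix_vector)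

lemma inner_transpose_mult:
  fixes A :: "real ^ 'd ^ 'k"
  shows "v \<bullet> (transpose A *v w) = (A *v v) \<bullet> w"
  by (metis dot_lmul_matrix inner_commute transpose_matrix_vector)

lemma wnorm_sq_add:
  assumes "sym_mat P"
  shows "wnorm_sq P (v + w) = wnorm_sq P v + 2 * (w \<bullet> (P *v v)) + wnorm_sq P w"
  using sym_mat_inner[OF assms, of v w]
  by (simp add: wnorm_sq_def matrix_vector_right_distrib inner_add_left inner_add_right)

lemma wnorm_sq_nonneg: "posdef P \<Longrightarrow> 0 \<le> wnorm_sq P v"
  by (cases "v = 0") (auto simp: wnorm_sq_def posdef_def less_imp_le)

lemma wnorm_sq_minus: "wnorm_sq P (- v) = wnorm_sq P v"
  using matrix_vector_mult_diff_distrib[of P 0 v] by (simp add: wnorm_sq_def)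

lemma wnorm_sq_swap: "wnorm_sq P (v - w) = wnorm_sq P (w - v)"
  by (metis minus_diff_eq wnorm_sq_minus)

text \<open>The function values cancel and only gradients remain. This turns divergences in the
  initial potential into explicit terms of \<open>admm_C1\<close>.\<close>

lemma bregman_add_swap:
  "bregman H f a b + bregman H f b a = wnorm_sq H (a - b) - (a - b) \<bullet> (grad f a - grad f b)"
  unfolding bregman_def wnorm_sq_swap[of H b a] by (simp add: algebra_simps inner_diff_left inner_diff_right)

text \<open>The vector paired with \<open>b' - a\<close> is the increment from \<open>b\<close> to
  \<open>b'\<close> of the gradient of \<open>1/2 * wnorm_sq H v - f v\<close>. Up to sign, an
  update leaves exactly this term in its optimality condition.\<close>

lemma bregman_three_point:
  assumes "sym_mat H"
  shows "bregman H f a b' - bregman H f a b + bregman H f b' b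
    = (b' - a) \<bullet> (H *v (b' - b) - (grad f b' - grad f b))"
proof -
  have "a - b = (a - b') + (b' - b)" by simp
  then have "wnorm_sq H (a - b)
      = wnorm_sq H (a - b') + 2 * ((b' - b) \<bullet> (H *v (a - b'))) + wnorm_sq H (b' - b)"
    using wnorm_sq_add[OF assms, of "a - b'" "b' - b"] by simp
  moreover have "(b' - b) \<bullet> (H *v (a - b')) = (a - b') \<bullet> (H *v (b' - b))"
    by (rule sym_mat_inner[OF assms])
  ultimately show ?thesis
    unfolding bregman_def by (simp add: algebra_simps inner_diff_left inner_diff_right)
qed

text \<open>The Hessian need not be continuous, so the mean value theorem is applied twice along the
  segment, to the function and then to its derivative. Convexity of \<open>C\<close> keeps the
  intermediate point where the Hessian bound holds.\<close>

lemma bregman_nonneg: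
  fixes f :: "real ^ 'n \<Rightarrow> real"
  assumes f: "twice_differentiable f"
    and dom: "convex C" "a \<in> C" "b \<in> C"
    and hess: "\<And>v. v \<in> C \<Longrightarrow> psd (H - hess f v)"
  shows "0 \<le> bregman H f a b"
proof -
  define d where "d = a - b"
  \<comment> \<open>The quadratic is centred at \<open>b\<close>, so that \<open>\<phi>' 0\<close>
    contains no term in \<open>H\<close> and \<open>\<phi> 1 - \<phi> 0 - \<phi>' 0\<close> is the
    divergence.\<close>
  define \<phi> where "\<phi> t = t\<^sup>2 / 2 * wnorm_sq H d - f (b + t *\<^sub>R d)" for t :: real
  define \<phi>' where "\<phi>' t = t * wnorm_sq H d - d \<bullet> grad f (b + t *\<^sub>R d)" for t :: real
  have line: "((\<lambda>t. b + t *\<^sub>R d) has_derivative (\<lambda>s. s *\<^sub>R d)) (at t)" for t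
    by (auto intro!: derivative_eq_intros)
  have "((\<lambda>t. f (b + t *\<^sub>R d)) has_derivative (\<lambda>s. (s *\<^sub>R d) \<bullet> grad f (b + t *\<^sub>R d))) (at t)" for t
    using f by (intro has_derivative_compose[OF line] gderiv_grad[unfolded gderiv_def])
      (auto simp: twice_differentiable_def)
  then have "((\<lambda>t. f (b + t *\<^sub>R d)) has_real_derivative d \<bullet> grad f (b + t *\<^sub>R d)) (at t)" for t
    unfolding has_field_derivative_def by (simp add: mult_commute_abs)
  then have der1: "(\<phi> has_real_derivative \<phi>' t) (at t)" for t
    unfolding \<phi>_def \<phi>'_def by (auto intro!: derivative_eq_intros)
  have der2: "(\<phi>' has_real_derivative d \<bullet> ((H - hess f (b + t *\<^sub>R d)) *v d)) (at t)" for t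
  proof -
    let ?D = "frechet_derivative (grad f) (at (b + t *\<^sub>R d))"
    have D: "(grad f has_derivative ?D) (at (b + t *\<^sub>R d))"
      using f by (simp add: twice_differentiable_def frechet_derivative_works)
    then have lin: "linear ?D" by (rule has_derivative_linear)
    have "((\<lambda>t. d \<bullet> grad f (b + t *\<^sub>R d)) has_derivative (\<lambda>s. d \<bullet> ?D (s *\<^sub>R d))) (at t)"
      by (intro has_derivative_inner_right has_derivative_compose[OF line D])
    then have "((\<lambda>t. d \<bullet> grad f (b + t *\<^sub>R d)) has_real_derivative d \<bullet> ?D d) (at t)"
      unfolding has_field_derivative_def by (simp add: linear_cmul[OF lin] mult_commute_abs)
    moreover have "hess f (b + t *\<^sub>R d) *v d = ?D d"
      using matrix_vector_mul(2)[OF lin] unfolding hess_def by metis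
    ultimately show ?thesis
      unfolding \<phi>'_def
      by (auto intro!: derivative_eq_intros
          simp: matrix_vector_mult_diff_rdistrib inner_diff_right wnorm_sq_def)
  qed
  have seg: "b + t *\<^sub>R d \<in> C" if "0 \<le> t" "t \<le> 1" for t
    using convexD_alt[OF dom(1,3,2) that] by (simp add: d_def algebra_simps)
  obtain t where t: "0 < t" "t < 1" "\<phi> 1 - \<phi> 0 = \<phi>' t"
    using MVT2[of 0 1 \<phi> \<phi>'] der1 by auto
  obtain s where s: "0 < s" "s < t" "\<phi>' t - \<phi>' 0 = t * (d \<bullet> ((H - hess f (b + s *\<^sub>R d)) *v d))"
    using MVT2[OF t(1) der2] by auto
  have "0 \<le> d \<bullet> ((H - hess f (b + s *\<^sub>R d)) *v d)"
    using hess[OF seg[of s]] s t by (auto simp: psd_def)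
  with s t have "0 \<le> \<phi> 1 - \<phi> 0 - \<phi>' 0"
    by simp
  also have "\<dots> = bregman H f a b"
    by (simp add: \<phi>_def \<phi>'_def bregman_def d_def)
  finally show ?thesis .
qed

section \<open>Positive definite matrices and the block matrix\<close>

text \<open>The quadratic form attains a positive minimum on the compact unit sphere; homogeneity of
  degree two makes this minimum a valid \<open>k\<close>.\<close>

lemma posdef_coercive:
  fixes P :: "real ^ 'n ^ 'n"
  assumes "posdef P"
  obtains k where "0 < k" "\<And>v. k * (norm v)\<^sup>2 \<le> v \<bullet> (P *v v)"
proof -
  have "continuous_on (sphere 0 1) (\<lambda>v. v \<bullet> (P *v v))"
    by (intro continuous_intros matrix_vector_mult_linear_continuous_on)
  moreover have "sphere (0 :: real ^ 'n) 1 \<noteq> {}" by simp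
  ultimately obtain e where e: "norm e = 1" "\<And>v. norm v = 1 \<Longrightarrow> e \<bullet> (P *v e) \<le> v \<bullet> (P *v v)"
    using continuous_attains_inf[OF compact_sphere, of "0 :: real ^ 'n" 1 "\<lambda>v. v \<bullet> (P *v v)"]
    by auto
  show thesis
  proof
    show "0 < e \<bullet> (P *v e)"
      using assms e(1) unfolding posdef_def by (metis norm_zero zero_neq_one)
    fix v
    show "e \<bullet> (P *v e) * (norm v)\<^sup>2 \<le> v \<bullet> (P *v v)"
    proof (cases "v = 0")
      case False
      then have "e \<bullet> (P *v e) \<le> sgn v \<bullet> (P *v sgn v)"
        by (intro e(2)) (simp add: norm_sgn)
      also have "\<dots> = v \<bullet> (P *v v) / (norm v)\<^sup>2"
        by (simp add: sgn_div_norm matrix_vector_mult_scaleR power2_eq_square divide_inverse)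
      finally show ?thesis
        using False by (simp add: field_simps)
    qed simp
  qed
qed

lemma posdef_matrix_inv:
  fixes S :: "real ^ 'n ^ 'n"
  assumes "posdef S"
  shows "S *v (matrix_inv S *v v) = v" "matrix_inv S *v (S *v v) = v"
proof -
  have "v = 0" if "S *v v = 0" for v
    using assms that by (force simp: posdef_def)
  then have "\<exists>B. B ** S = mat 1"
    using matrix_left_invertible_ker by blast
  then have "invertible S"
    by (simp add: invertible_left_inverse)
  then have "S ** matrix_inv S = mat 1 \<and> matrix_inv S ** S = mat 1"
    unfolding invertible_def matrix_inv_def by (rule someI_ex)
  then show "S *v (matrix_inv S *v v) = v" "matrix_inv S *v (S *v v) = v"
    by (simp_all add: matrix_vector_mul_assoc)
qed

lemma sum_UNIV_Plus:
  fixes h :: "'a::finite + 'b::finite \<Rightarrow> real"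
  shows "sum h UNIV = (\<Sum>a\<in>UNIV. h (Inl a)) + (\<Sum>b\<in>UNIV. h (Inr b))"
  by (simp add: UNIV_Plus_UNIV[symmetric] sum.Plus del: UNIV_Plus_UNIV)

lemma join_vec_diff: "join_vec x y u - join_vec x' y' u' = join_vec (x - x') (y - y') (u - u')"
  by (simp add: join_vec_def vec_eq_iff split: sum.splits)

lemma inner_join_vec: "join_vec x y u \<bullet> join_vec x' y' u' = x \<bullet> x' + y \<bullet> y' + u \<bullet> u'"
  by (simp add: inner_vec_def sum_UNIV_Plus join_vec_def)

lemma admm_M_mult_join_vec:
  "admm_M A S Hf Hg *v join_vec x y u
   = join_vec ((Hf + transpose A ** S ** A) *v x + transpose A *v u) (Hg *v y)
       (A *v x + matrix_inv S *v u)"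
  by (simp add: vec_eq_iff join_vec_def admm_M_def matrix_vector_mult_def sum_UNIV_Plus split: sum.splits)

text \<open>Completing the square: \<open>wnorm_sq S (A *v x)\<close>,
  \<open>2 * ((A *v x) \<bullet> u)\<close> and \<open>u \<bullet> (matrix_inv S *v u)\<close> merge
  into one \<open>S\<close>-norm. This links the \<open>M\<close>-norm in the constant to the vector
  \<open>p_t\<close> of the potential.\<close>

lemma wnorm_sq_admm_M:
  assumes "sym_mat S" "posdef S"
  shows "wnorm_sq (admm_M A S Hf Hg) (join_vec x y u)
    = wnorm_sq Hf x + wnorm_sq Hg y + wnorm_sq S (A *v x + matrix_inv S *v u)"
proof -
  have "transpose A ** S ** A *v x = transpose A *v (S *v (A *v x))"
    by (simp add: matrix_vector_mul_assoc matrix_mul_assoc del: transpose_matrix_vector)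
  moreover have "(matrix_inv S *v u) \<bullet> (S *v (A *v x)) = (A *v x) \<bullet> u"
    using sym_mat_inner[OF assms(1), of "matrix_inv S *v u" "A *v x"]
    by (simp add: posdef_matrix_inv(1)[OF assms(2)])
  ultimately show ?thesis
    by (simp add: wnorm_sq_def admm_M_mult_join_vec inner_join_vec matrix_vector_mult_add_rdistrib
      matrix_vector_right_distrib inner_add_left inner_add_right inner_transpose_mult
      posdef_matrix_inv(1)[OF assms(2)] inner_commute[of u] del: transpose_matrix_vector)
qed

section \<open>Existence of the minimisers in the updates\<close>

text \<open>Without a minimiser, the sets \<open>{v. F z < F v}\<close> for \<open>z\<close> in
  \<open>K\<close> would form an open cover of \<open>K\<close>. In a finite subcover, an index with
  the smallest value of \<open>F\<close> lies in none of the sets.\<close>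

lemma lsc_attains_inf:
  fixes F :: "'a::topological_space \<Rightarrow> ereal"
  assumes K: "compact K" "K \<noteq> {}" and op: "\<And>a. open {x. a < F x}"
  obtains z where "z \<in> K" "\<And>v. v \<in> K \<Longrightarrow> F z \<le> F v"
proof (rule ccontr)
  assume "\<not> thesis"
  then have "K \<subseteq> (\<Union>z\<in>K. {v. F z < F v})"
    using that by (fastforce simp: not_le)
  then obtain I where I: "I \<subseteq> K" "finite I" "K \<subseteq> (\<Union>z\<in>I. {v. F z < F v})"
    using compactE_image[OF K(1)] op by metis
  with K(2) have "I \<noteq> {}" by auto
  then obtain z where "z \<in> I" "\<And>w. w \<in> I \<Longrightarrow> F z \<le> F w"
    using ex_is_arg_min_if_finite[OF I(2), of F] by (auto simp: is_arg_min_def not_less)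
  with I show False
    by (fastforce simp: not_le[symmetric])
qed

lemma open_superlevel:
  fixes h :: "'a::metric_space \<Rightarrow> ereal" and q :: "'a \<Rightarrow> real"
  assumes lsc: "lsc_fun h" and q: "continuous_on UNIV q"
  shows "open {x. a < h x + ereal (q x)}"
proof (cases a)
  case (real r)
  have eq: "a < h x + ereal (q x) \<longleftrightarrow> ereal (r - q x) < h x" for x
    using real by (cases "h x") auto
  show ?thesis
    unfolding eq
  proof (subst open_subopen, intro ballI)
    fix x assume "x \<in> {x. ereal (r - q x) < h x}"
    \<comment> \<open>A real number strictly in between splits the inequality: near
      \<open>x\<close>, \<open>h\<close> stays above \<open>b\<close> and \<open>q\<close> stays
      above \<open>r - b\<close>.\<close>
    then obtain b where b: "r - q x < b" "ereal b < h x"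
      using ereal_dense2 by (metis less_ereal.simps(1) mem_Collect_eq)
    have "h x \<le> Liminf (at x) h"
      using lsc by (simp add: lsc_fun_def)
    with b(2) have "\<forall>\<^sub>F v in at x. ereal b < h v"
      by (auto simp: le_Liminf_iff)
    \<comment> \<open>The filter \<open>at x\<close> leaves out the point \<open>x\<close> itself;
      \<open>b(2)\<close> adds it back.\<close>
    with b(2) have "\<forall>\<^sub>F v in nhds x. ereal b < h v"
      by (simp add: eventually_at_filter eventually_mono) (smt (verit) eventually_mono)
    moreover have "(q \<longlongrightarrow> q x) (nhds x)"
      using q by (simp add: continuous_on_eq_continuous_at isCont_def tendsto_at_iff_tendsto_nhds)
    then have "\<forall>\<^sub>F v in nhds x. r - b < q v"
      using b(1) by (intro order_tendstoD(1)) auto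
    ultimately have "\<forall>\<^sub>F v in nhds x. ereal (r - q v) < h v"
    proof eventually_elim
      case (elim v)
      have "ereal (r - q v) < ereal b" using elim by simp
      then show ?case using elim(1) by (rule less_trans)
    qed
    then show "\<exists>T. open T \<and> x \<in> T \<and> T \<subseteq> {x. ereal (r - q x) < h x}"
      by (auto simp: eventually_nhds)
  qed
next
  case MInf
  have eq: "a < h x + ereal (q x) \<longleftrightarrow> - \<infinity> < h x" for x
    using MInf by (cases "h x") auto
  show ?thesis
    unfolding eq
  proof (subst open_subopen, intro ballI)
    fix x assume x: "x \<in> {x. - \<infinity> < h x}"
    have "h x \<le> Liminf (at x) h"
      using lsc by (simp add: lsc_fun_def)
    with x have "\<forall>\<^sub>F v in at x. - \<infinity> < h v"
      by (metis le_Liminf_iff mem_Collect_eq)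
    with x show "\<exists>T. open T \<and> x \<in> T \<and> T \<subseteq> {x. - \<infinity> < h x}"
      by (force simp: eventually_at_topological)
  qed
qed simp

lemma convex_funD:
  assumes "convex_fun h" "0 \<le> t" "t \<le> 1"
  shows "h ((1 - t) *\<^sub>R v + t *\<^sub>R w) \<le> ereal (1 - t) * h v + ereal t * h w"
  using assms by (simp add: convex_fun_def)

text \<open>By convexity \<open>h\<close> falls at most linearly away from \<open>a\<close>, while
  \<open>q\<close> grows quadratically, so minimising over a compact ball is enough.
  \<open>G\<close> is the gradient of \<open>q\<close>, and \<open>P\<close> its constant
  second-order part.\<close>

lemma exists_prox_point:
  fixes h :: "real ^ 'n \<Rightarrow> ereal" and q :: "real ^ 'n \<Rightarrow> real" and P :: "real ^ 'n ^ 'n"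
  assumes cvx: "convex_fun h" and proper: "proper_fun h" and lsc: "lsc_fun h" and P: "posdef P"
    and q: "\<And>v w. q (v + w) = q v + w \<bullet> G v + 1/2 * (w \<bullet> (P *v w))"
  shows "\<exists>z. \<forall>v. h z + ereal (q z) \<le> h v + ereal (q v)"
proof -
  obtain a where "h a < \<infinity>" "\<And>v. h v \<noteq> - \<infinity>"
    using proper by (auto simp: proper_fun_def)
  then obtain ra where ra: "h a = ereal ra"
    by (cases "h a") auto
  obtain k where k: "0 < k" "\<And>v. k * (norm v)\<^sup>2 \<le> v \<bullet> (P *v v)"
    using posdef_coercive[OF P] by blast
  have q': "q v = q a + (v - a) \<bullet> G a + 1/2 * ((v - a) \<bullet> (P *v (v - a)))" for v
    using q[of a "v - a"] by simp
  have q_cont: "continuous_on UNIV q"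
  proof -
    have eq: "q v = q 0 + v \<bullet> G 0 + 1/2 * (v \<bullet> (P *v v))" for v
      using q[of 0 v] by simp
    have "continuous_on UNIV (\<lambda>v. q 0 + v \<bullet> G 0 + 1/2 * (v \<bullet> (P *v v)))"
      by (intro continuous_intros matrix_vector_mult_linear_continuous_on)
    then show ?thesis by (rule continuous_on_eq) (rule eq[symmetric])
  qed
  have "open {x. b < h x}" for b
    using open_superlevel[OF lsc continuous_on_const[of UNIV 0]] by (simp add: zero_ereal_def[symmetric])
  \<comment> \<open>The minimum of \<open>h\<close> on the unit ball replaces an affine minorant:
    convexity along the ray from \<open>a\<close> through \<open>v\<close> extends it to distance
    \<open>r\<close> as a loss of at most \<open>r * (ra - m)\<close>.\<close>
  then obtain z1 where z1: "\<And>v. v \<in> cball a 1 \<Longrightarrow> h z1 \<le> h v"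
    using lsc_attains_inf[OF compact_cball, of a 1 h] by (metis cball_eq_empty not_one_less_zero)
  have "h z1 \<le> ereal ra" using z1[of a] ra by simp
  then obtain m where m: "h z1 = ereal m"
    using \<open>h z1 \<le> _\<close> \<open>\<And>v. h v \<noteq> - \<infinity>\<close> by (cases "h z1") auto
  \<comment> \<open>At distance \<open>r\<close> the linear losses are at most
    \<open>(ra - m + norm (G a)) * r\<close> and the quadratic gain at least
    \<open>k * r\<^sup>2 / 2\<close>, which balances at the second entry. The entry 1 puts the point
    at distance one from \<open>a\<close> between \<open>a\<close> and \<open>v\<close>.\<close>
  define R where "R = max 1 (2 * (ra - m + norm (G a)) / k)"
  have R: "1 \<le> R" by (simp add: R_def)
  have far: "h a + ereal (q a) \<le> h v + ereal (q v)" if v: "R < norm (v - a)" for v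
  proof (cases "h v")
    case (real rv)
    define r where "r = norm (v - a)"
    have r: "1 < r" "0 < r" using v R by (auto simp: r_def)
    have "h ((1 - 1/r) *\<^sub>R a + (1/r) *\<^sub>R v) \<le> ereal (1 - 1/r) * h a + ereal (1/r) * h v"
      using r by (intro convex_funD[OF cvx]) (auto simp: field_simps)
    moreover have "(1 - 1/r) *\<^sub>R a + (1/r) *\<^sub>R v = a + (1/r) *\<^sub>R (v - a)"
      by (simp add: algebra_simps)
    moreover have "a + (1/r) *\<^sub>R (v - a) \<in> cball a 1"
      using r by (simp add: r_def dist_norm)
    ultimately have "ereal m \<le> ereal ((1 - 1/r) * ra + (1/r) * rv)"
      using z1[of "a + (1/r) *\<^sub>R (v - a)"] m ra real order_trans by fastforce
    then have "m * r \<le> (r - 1) * ra + rv"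
      using r by (simp add: field_simps)
    moreover have "- (r * norm (G a)) \<le> (v - a) \<bullet> G a"
      using Cauchy_Schwarz_ineq2[of "v - a" "G a"] by (simp add: r_def)
    moreover have "k * r\<^sup>2 \<le> (v - a) \<bullet> (P *v (v - a))"
      using k(2)[of "v - a"] by (simp add: r_def)
    moreover have "2 * (ra - m + norm (G a)) / k \<le> r"
      using v by (simp add: r_def R_def)
    then have "2 * (ra - m + norm (G a)) \<le> k * r"
      using k(1) by (simp add: field_simps)
    then have "2 * (ra - m + norm (G a)) * r \<le> k * r\<^sup>2"
      using mult_right_mono[of _ "k * r" r] r by (simp add: power2_eq_square)
    ultimately have "ra + q a \<le> rv + q v"
      using q'[of v] by (simp add: algebra_simps)
    then show ?thesis using real ra by simp
  next
    case MInf
    then show ?thesis using \<open>\<And>v. h v \<noteq> - \<infinity>\<close> by simp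
  qed simp
  obtain z where z: "\<And>v. v \<in> cball a R \<Longrightarrow> h z + ereal (q z) \<le> h v + ereal (q v)"
    using lsc_attains_inf[OF compact_cball _ open_superlevel[OF lsc q_cont], of a R] R
    by (metis cball_eq_empty not_less not_one_less_zero order_trans)
  have "h z + ereal (q z) \<le> h v + ereal (q v)" for v
  proof (cases "v \<in> cball a R")
    case False
    then have "h a + ereal (q a) \<le> h v + ereal (q v)"
      by (intro far) (simp add: dist_norm norm_minus_commute)
    with z[of a] R show ?thesis by (simp add: order_trans)
  qed (rule z)
  then show ?thesis by blast
qed

section \<open>First-order optimality of the updates\<close>

text \<open>Minimality is tested against \<open>z + t *\<^sub>R w\<close>: convexity bounds the
  change of \<open>h\<close> by \<open>t\<close> times its change over the full step, and
  \<open>Q\<close> enters with \<open>t\<^sup>2\<close>. Dividing by \<open>t\<close> and letting it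
  tend to 0 removes \<open>Q\<close>.\<close>

lemma prox_point_subgradient:
  fixes h :: "'a::real_inner \<Rightarrow> ereal" and q :: "'a \<Rightarrow> real"
  assumes cvx: "convex_fun h" and proper: "proper_fun h"
    and q: "\<And>w t. q (z + t *\<^sub>R w) = q z + t * (w \<bullet> G) + t\<^sup>2 * Q w"
    and min: "\<And>v. h z + ereal (q z) \<le> h v + ereal (q v)"
  shows "h z < \<infinity>" "h z + ereal (w \<bullet> - G) \<le> h (z + w)"
proof -
  obtain a where a: "h a < \<infinity>" and nm: "\<And>v. h v \<noteq> - \<infinity>"
    using proper by (auto simp: proper_fun_def)
  show fin: "h z < \<infinity>"
    using min[of a] a by auto
  then obtain r where r: "h z = ereal r"
    using nm[of z] by (cases "h z") auto
  show "h z + ereal (w \<bullet> - G) \<le> h (z + w)"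
  proof (cases "h (z + w)")
    case (real s)
    have le: "r - w \<bullet> G \<le> s + t * Q w" if t: "0 < t" "t < 1" for t
    proof -
      have "h ((1 - t) *\<^sub>R z + t *\<^sub>R (z + w)) \<le> ereal (1 - t) * h z + ereal t * h (z + w)"
        using t by (intro convex_funD[OF cvx]) auto
      moreover have "(1 - t) *\<^sub>R z + t *\<^sub>R (z + w) = z + t *\<^sub>R w"
        by (simp add: algebra_simps)
      ultimately have "h (z + t *\<^sub>R w) \<le> ereal ((1 - t) * r + t * s)"
        using r real by simp
      then have "h z + ereal (q z) \<le> ereal ((1 - t) * r + t * s) + ereal (q (z + t *\<^sub>R w))"
        using min[of "z + t *\<^sub>R w"] add_right_mono order_trans by blast
      then have "0 \<le> t * (s - r + w \<bullet> G + t * Q w)"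
        using r q[of t w] by (simp add: algebra_simps power2_eq_square)
      then show ?thesis
        using t by (simp add: zero_le_mult_iff)
    qed
    have "((\<lambda>t. s + t * Q w) \<longlongrightarrow> s + 0 * Q w) (at_right 0)"
      by (intro tendsto_intros)
    moreover have "\<forall>\<^sub>F t in at_right 0. r - w \<bullet> G \<le> s + t * Q w"
      by (rule eventually_at_rightI[of 0 1]) (auto intro: le)
    ultimately have "r - w \<bullet> G \<le> s + 0 * Q w"
      by (intro tendsto_lowerbound) auto
    then show ?thesis using r real by simp
  qed (use nm in auto)
qed

text \<open>Difference quotients of a convex function are monotone in \<open>t\<close>, so they
  converge in \<open>ereal\<close> to their infimum, which the subgradient inequality bounds from
  below. The differentiable \<open>p\<close> shifts this limit by its directional
  derivative.\<close>

lemma convex_subgradient_imp_subdiff: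
  fixes h :: "'a::euclidean_space \<Rightarrow> ereal" and p :: "'a \<Rightarrow> real"
  assumes cvx: "convex_fun h" and proper: "proper_fun h" and p: "p differentiable (at z)"
    and fin: "h z < \<infinity>" and sub: "\<And>w. h z + ereal (w \<bullet> \<xi>) \<le> h (z + w)"
    and f: "\<And>v. f v = h v + ereal (p v)"
  shows "\<xi> + grad p z \<in> subdiff f z"
proof -
  have nm: "h v \<noteq> - \<infinity>" for v
    using proper by (auto simp: proper_fun_def)
  obtain r where r: "h z = ereal r"
    using nm[of z] fin by (cases "h z") auto
  have "\<exists>L. ((\<lambda>t. (f (z + t *\<^sub>R w) - f z) / ereal t) \<longlongrightarrow> L) (at_right 0)
      \<and> ereal ((\<xi> + grad p z) \<bullet> w) \<le> L" for w
  proof -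
    define \<phi> where "\<phi> t = (h (z + t *\<^sub>R w) - h z) / ereal t" for t :: real
    define \<psi> where "\<psi> t = (p (z + t *\<^sub>R w) - p z) / t" for t
    have lb: "ereal (w \<bullet> \<xi>) \<le> \<phi> t" if "0 < t" for t
      using sub[of "t *\<^sub>R w"] that r nm[of "z + t *\<^sub>R w"]
      by (cases "h (z + t *\<^sub>R w)") (auto simp: \<phi>_def field_simps)
    have mono: "\<phi> s \<le> \<phi> t" if st: "0 < s" "s \<le> t" for s t
    proof (cases "h (z + t *\<^sub>R w)")
      case (real b)
      have "h ((1 - s/t) *\<^sub>R z + (s/t) *\<^sub>R (z + t *\<^sub>R w))
          \<le> ereal (1 - s/t) * h z + ereal (s/t) * h (z + t *\<^sub>R w)"
        using st by (intro convex_funD[OF cvx]) (auto simp: field_simps)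
      moreover have "(1 - s/t) *\<^sub>R z + (s/t) *\<^sub>R (z + t *\<^sub>R w) = z + s *\<^sub>R w"
        using st by (simp add: algebra_simps)
      ultimately have *: "h (z + s *\<^sub>R w) \<le> ereal ((1 - s/t) * r + (s/t) * b)"
        using real r by simp
      then obtain d where d: "h (z + s *\<^sub>R w) = ereal d"
        using nm[of "z + s *\<^sub>R w"] by (cases "h (z + s *\<^sub>R w)") auto
      have "d \<le> (1 - s/t) * r + (s/t) * b"
        using * d by simp
      then have "(d - r) / s \<le> (b - r) / t"
        using st by (simp add: field_simps)
      then show ?thesis using st real r d by (simp add: \<phi>_def)
    qed (use st nm r in \<open>auto simp: \<phi>_def\<close>)
    \<comment> \<open>\<open>L\<close> is \<open>\<infinity>\<close> when the ray leaves the domain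
      at once; adding the limit of \<open>\<psi>\<close> stays well defined because that limit is
      real.\<close>
    define L where "L = Inf (\<phi> ` ({0<..} \<inter> UNIV))"
    have \<phi>L: "(\<phi> \<longlongrightarrow> L) (at_right 0)"
      using Lim_right_bound[of UNIV 0 \<phi> "- \<infinity>"] mono by (auto simp: L_def)
    have L: "ereal (w \<bullet> \<xi>) \<le> L"
      unfolding L_def by (rule INF_greatest) (auto intro: lb)
    have line: "((\<lambda>t. z + t *\<^sub>R w) has_derivative (\<lambda>s. s *\<^sub>R w)) (at 0)"
      by (auto intro!: derivative_eq_intros)
    have "(p has_derivative (\<lambda>h. h \<bullet> grad p z)) (at z)"
      using gderiv_grad[OF p] by (simp add: gderiv_def)
    then have "((\<lambda>t. p (z + t *\<^sub>R w)) has_derivative (\<lambda>s. (s *\<^sub>R w) \<bullet> grad p z)) (at 0)"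
      using has_derivative_compose[OF line, of p "\<lambda>h. h \<bullet> grad p z"] by simp
    then have "((\<lambda>t. p (z + t *\<^sub>R w)) has_real_derivative w \<bullet> grad p z) (at 0)"
      unfolding has_field_derivative_def by (simp add: mult_commute_abs)
    then have "(\<psi> \<longlongrightarrow> w \<bullet> grad p z) (at_right 0)"
      unfolding \<psi>_def DERIV_def by (auto intro: filterlim_at_split[THEN iffD1, THEN conjunct2])
    then have \<psi>L: "((\<lambda>t. ereal (\<psi> t)) \<longlongrightarrow> ereal (w \<bullet> grad p z)) (at_right 0)"
      by simp
    have "((\<lambda>t. \<phi> t + ereal (\<psi> t)) \<longlongrightarrow> L + ereal (w \<bullet> grad p z)) (at_right 0)"
      using L by (intro tendsto_add_ereal_general \<phi>L \<psi>L) auto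
    moreover have "\<forall>\<^sub>F t in at_right 0. \<phi> t + ereal (\<psi> t) = (f (z + t *\<^sub>R w) - f z) / ereal t"
      using eventually_at_right_less[of 0]
    proof eventually_elim
      case (elim t)
      then show ?case
        using nm[of "z + t *\<^sub>R w"] r unfolding \<phi>_def \<psi>_def f
        by (cases "h (z + t *\<^sub>R w)") (auto simp: field_simps)
    qed
    ultimately have "((\<lambda>t. (f (z + t *\<^sub>R w) - f z) / ereal t) \<longlongrightarrow> L + ereal (w \<bullet> grad p z)) (at_right 0)"
      by (rule Lim_transform_eventually)
    moreover have "ereal ((\<xi> + grad p z) \<bullet> w) \<le> L + ereal (w \<bullet> grad p z)"
      using add_right_mono[OF L, of "ereal (w \<bullet> grad p z)"] by (simp add: inner_commute[of _ w] inner_add_right)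
    ultimately show ?thesis by blast
  qed
  then show ?thesis
    using fin by (auto simp: subdiff_def eff_dom_def f r)
qed

text \<open>Both block updates are instances, with \<open>K\<close> as \<open>A\<close> or
  \<open>B\<close> and \<open>b\<close> collecting the other block. The negative gradient of the
  quadratic part at \<open>z\<close> is a subgradient of \<open>h\<close>; adding
  \<open>grad p z\<close> makes it one of \<open>f\<close>.\<close>

lemma admm_update:
  fixes h f :: "real ^ 'n \<Rightarrow> ereal" and p :: "real ^ 'n \<Rightarrow> real" and K :: "real ^ 'n ^ 'k"
    and S :: "real ^ 'k ^ 'k" and H :: "real ^ 'n ^ 'n"
  assumes cvx: "convex_fun h" and proper: "proper_fun h" and lsc: "lsc_fun h"
    and p: "p differentiable (at z)" and f: "\<And>v. f v = h v + ereal (p v)"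
    and S: "sym_mat S" and H: "sym_mat H" and P: "posdef (H + transpose K ** S ** K)"
    and z: "z = arg_min (\<lambda>v. h v + ereal (v \<bullet> l + 1/2 * wnorm_sq S (r v) + 1/2 * wnorm_sq H (v - a))) (\<lambda>_. True)"
    and r: "\<And>v. r v = K *v v + b"
  shows "grad p z - (l + transpose K *v (S *v r z) + H *v (z - a)) \<in> subdiff f z"
proof -
  define q where "q v = v \<bullet> l + 1/2 * wnorm_sq S (r v) + 1/2 * wnorm_sq H (v - a)" for v
  define P where "P = H + transpose K ** S ** K"
  define G where "G v = l + transpose K *v (S *v r v) + H *v (v - a)" for v
  have Pv: "w \<bullet> (P *v w) = wnorm_sq S (K *v w) + wnorm_sq H w" for w
  proof -
    have "transpose K ** S ** K *v w = transpose K *v (S *v (K *v w))"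
      by (simp add: matrix_vector_mul_assoc matrix_mul_assoc del: transpose_matrix_vector)
    then show ?thesis
      by (simp add: P_def wnorm_sq_def matrix_vector_mult_add_rdistrib inner_add_right inner_transpose_mult
        del: transpose_matrix_vector)
  qed
  have q: "q (v + w) = q v + w \<bullet> G v + 1/2 * (w \<bullet> (P *v w))" for v w
  proof -
    have "r (v + w) = r v + K *v w" "(v + w) - a = (v - a) + w"
      by (simp_all add: r matrix_vector_right_distrib)
    then show ?thesis
      unfolding Pv q_def G_def \<open>(v + w) - a = _\<close>
      by (simp add: add_divide_distrib wnorm_sq_add[OF S] wnorm_sq_add[OF H] inner_add_left inner_add_right inner_transpose_mult
        del: transpose_matrix_vector)
  qed
  \<comment> \<open>\<open>arg_min\<close> is a choice, so \<open>z\<close> has the minimising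
    property only once a minimiser is known to exist.\<close>
  have "\<exists>z. is_arg_min (\<lambda>v. h v + ereal (q v)) (\<lambda>_. True) z"
    using exists_prox_point[OF cvx proper lsc P[folded P_def] q] by (auto simp: is_arg_min_def not_less)
  then have "is_arg_min (\<lambda>v. h v + ereal (q v)) (\<lambda>_. True) z"
    unfolding z q_def arg_min_def by (rule someI_ex)
  then have min: "h z + ereal (q z) \<le> h v + ereal (q v)" for v
    by (auto simp: is_arg_min_def not_less)
  have qt: "q (z + t *\<^sub>R w) = q z + t * (w \<bullet> G z) + t\<^sup>2 * (1/2 * (w \<bullet> (P *v w)))" for t w
    by (simp add: q matrix_vector_mult_scaleR power2_eq_square)
  note sub = prox_point_subgradient[OF cvx proper qt min]
  have "- G z + grad p z \<in> subdiff f z"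
    by (rule convex_subgradient_imp_subdiff[OF cvx proper p sub f])
  then show ?thesis unfolding G_def by (simp add: algebra_simps)
qed

lemma convex_eff_dom:
  assumes "convex_fun h" "\<And>v. f v = h v + ereal (p v)"
  shows "convex (eff_dom f)"
proof -
  have "h (a *\<^sub>R v + b *\<^sub>R w) < \<infinity>"
    if "h v < \<infinity>" "h w < \<infinity>" "0 \<le> a" "0 \<le> b" "a + b = 1" for v w a b
  proof -
    have "h (a *\<^sub>R v + b *\<^sub>R w) \<le> ereal a * h v + ereal b * h w"
      using assms(1) that by (simp add: convex_fun_def)
    also have "\<dots> < \<infinity>"
      using that by (cases "h v"; cases "h w") auto
    finally show ?thesis .
  qed
  then show ?thesis
    by (auto simp: convex_def eff_dom_def assms(2))
qed

section \<open>The gain \<open>min_quad_lin\<close> and the first-order residuals\<close>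

text \<open>A tangent of the parabola at \<open>s\<close> lies below both branches as long as its
  slope \<open>2 * s\<close> is at most \<open>c\<close>. Taking \<open>s\<close> as the smaller of
  \<open>R\<close> and \<open>c / 2\<close>, the tangent reaches at least half of the value at
  \<open>R\<close>.\<close>

lemma min_quad_lin_tangent:
  assumes c: "0 < c" and R: "0 \<le> R"
  obtains s where "0 \<le> s" "min_quad_lin c R \<le> 2 * (2 * s * R - s\<^sup>2)"
    "\<And>r. 0 \<le> r \<Longrightarrow> 2 * s * r - s\<^sup>2 \<le> min_quad_lin c r"
proof (cases c)
  case (real k)
  with c have k: "0 < k" by simp
  define s where "s = min R (k / 2)"
  show thesis
  proof (rule that)
    show "0 \<le> s" using k R by (simp add: s_def)
    show "min_quad_lin c R \<le> 2 * (2 * s * R - s\<^sup>2)"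
    proof (cases "R \<le> k / 2")
      case True
      then have "s = R" by (simp add: s_def)
      then show ?thesis using real by (simp add: min_quad_lin_def power2_eq_square min.coboundedI1)
    next
      case False
      then have s: "s = k / 2" and "k * (k / 2) \<le> k * R"
        using k by (simp_all add: s_def)
      then have "k * R \<le> 2 * (2 * s * R - s\<^sup>2)"
        unfolding s by (simp add: power2_eq_square mult.commute)
      then show ?thesis using real by (simp add: min_quad_lin_def)
    qed
    fix r :: real assume r: "0 \<le> r"
    have "0 \<le> (s - r)\<^sup>2" by simp
    then have "2 * s * r - s\<^sup>2 \<le> r\<^sup>2"
      by (simp add: power2_eq_square algebra_simps)
    moreover have "2 * s * r \<le> k * r"
      using r by (intro mult_right_mono) (auto simp: s_def)
    ultimately show "2 * s * r - s\<^sup>2 \<le> min_quad_lin c r"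
      using real by (simp add: min_quad_lin_def) (smt (verit) zero_le_power2)
  qed
next
  case PInf
  show thesis
  proof (rule that)
    show "0 \<le> R" by fact
    show "min_quad_lin c R \<le> 2 * (2 * R * R - R\<^sup>2)"
      using PInf by (simp add: min_quad_lin_def power2_eq_square)
    fix r :: real
    have "0 \<le> (R - r)\<^sup>2" by simp
    then show "2 * R * r - R\<^sup>2 \<le> min_quad_lin c r"
      using PInf by (simp add: min_quad_lin_def power2_eq_square algebra_simps)
  qed
qed (use c in simp)

lemma min_quad_lin_nonneg: "0 < c \<Longrightarrow> 0 \<le> r \<Longrightarrow> 0 \<le> min_quad_lin c r"
  by (cases c) (auto simp: min_quad_lin_def)

text \<open>The tangent at the averaged point is affine and nondecreasing, so the triangle
  inequality for the mean passes through it. The factor 2 is the loss in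
  \<open>min_quad_lin_tangent\<close>.\<close>

lemma min_quad_lin_average:
  fixes x :: "nat \<Rightarrow> 'a::real_normed_vector"
  assumes c: "0 < c" and T: "1 \<le> T"
  shows "min_quad_lin c (norm ((1 / real T) *\<^sub>R (\<Sum>t=1..T. x t) - a))
    \<le> 2 / real T * (\<Sum>t=1..T. min_quad_lin c (norm (x t - a)))"
proof -
  let ?R = "norm ((1 / real T) *\<^sub>R (\<Sum>t=1..T. x t) - a)"
  obtain s where s: "0 \<le> s" "min_quad_lin c ?R \<le> 2 * (2 * s * ?R - s\<^sup>2)"
    "\<And>r. 0 \<le> r \<Longrightarrow> 2 * s * r - s\<^sup>2 \<le> min_quad_lin c r"
    using min_quad_lin_tangent[OF c, of ?R] by auto
  have "(1 / real T) *\<^sub>R (\<Sum>t=1..T. x t) - a = (1 / real T) *\<^sub>R (\<Sum>t=1..T. x t - a)"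
    using T by (simp add: sum_subtractf scaleR_diff_right scaleR_sum_right sum_constant_scaleR)
  then have "?R = 1 / real T * norm (\<Sum>t=1..T. x t - a)"
    by simp
  also have "\<dots> \<le> 1 / real T * (\<Sum>t=1..T. norm (x t - a))"
    by (intro mult_left_mono norm_sum) simp
  finally have R: "real T * ?R \<le> (\<Sum>t=1..T. norm (x t - a))"
    using T by (simp add: field_simps)
  have "real T * (2 * s * ?R - s\<^sup>2) \<le> (\<Sum>t=1..T. 2 * s * norm (x t - a) - s\<^sup>2)"
    using mult_left_mono[OF R, of "2 * s"] s(1)
    by (simp add: sum_subtractf sum_distrib_left[symmetric] algebra_simps)
  also have "\<dots> \<le> (\<Sum>t=1..T. min_quad_lin c (norm (x t - a)))"
    by (intro sum_mono s(3)) simp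
  finally have "real T * (2 * s * ?R - s\<^sup>2) \<le> (\<Sum>t=1..T. min_quad_lin c (norm (x t - a)))" .
  then show ?thesis
    using T s(2) mult_left_mono[OF s(2), of "real T"] by (simp add: field_simps)
qed

text \<open>Each entry of \<open>fosp_tol\<close> serves one branch of \<open>min_quad_lin\<close>:
  \<open>sqrt \<alpha> * e\<close> the quadratic one by Young's inequality,
  \<open>\<alpha> * c / 2\<close> the linear one by Cauchy-Schwarz. Only half of the gain is
  spent.\<close>

lemma fosp_residual:
  assumes c: "0 < c" and \<alpha>: "0 \<le> \<alpha>" and v: "norm v \<le> fosp_tol \<alpha> c e"
  shows "w \<bullet> v \<le> 1/2 * (\<alpha> * min_quad_lin c (norm w)) + 1/2 * e\<^sup>2"
proof -
  define r where "r = norm w"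
  have r: "0 \<le> r" by (simp add: r_def)
  have wv: "w \<bullet> v \<le> norm v * r"
    using norm_cauchy_schwarz[of w v] by (simp add: r_def mult.commute)
  have quad: "w \<bullet> v \<le> 1/2 * (\<alpha> * r\<^sup>2) + 1/2 * e\<^sup>2"
  proof -
    have "norm v \<le> sqrt \<alpha> * e"
      using v by (auto simp: fosp_tol_def split: if_splits)
    then have "w \<bullet> v \<le> sqrt \<alpha> * e * r"
      using wv r by (meson mult_right_mono order_trans)
    moreover have "0 \<le> (sqrt \<alpha> * r - e)\<^sup>2" by simp
    then have "2 * (sqrt \<alpha> * e * r) \<le> \<alpha> * r\<^sup>2 + e\<^sup>2"
      using \<alpha> by (simp add: power2_diff power_mult_distrib algebra_simps)
    ultimately show ?thesis by simp
  qed
  show ?thesis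
  \<comment> \<open>Infinite \<open>c\<close> falls under the first case, so in the second one
    \<open>c\<close> is a real \<open>k\<close>.\<close>
  proof (cases "min_quad_lin c r = r\<^sup>2")
    case True
    then show ?thesis using quad by (simp add: r_def)
  next
    case False
    then obtain k where k: "c = ereal k" "min_quad_lin c r = k * r"
      using c by (cases c) (auto simp: min_quad_lin_def min_def split: if_splits)
    then have "norm v \<le> \<alpha> * k / 2"
      using v by (auto simp: fosp_tol_def)
    then have "w \<bullet> v \<le> \<alpha> * k / 2 * r"
      using wv r by (meson mult_right_mono order_trans)
    then show ?thesis using k by (simp add: r_def[symmetric] add_increasing2)
  qed
qed

section \<open>Descent of the potential and the convergence bound\<close>

text \<open>Here \<open>x\<close>, \<open>x'\<close> stand for \<open>x_(t+1)\<close>,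
  \<open>x_(t+2)\<close>, but \<open>y\<close>, \<open>y'\<close> for \<open>y_t\<close>,
  \<open>y_(t+1)\<close>, and \<open>u'\<close> for \<open>u_(t+1)\<close>. With this shift
  \<open>p' - p\<close> is the infeasibility of the pair \<open>x'\<close>,
  \<open>y'\<close>.\<close>

lemma admm_descent:
  fixes A :: "real ^ 'd ^ 'k" and B :: "real ^ 'm ^ 'k" and S :: "real ^ 'k ^ 'k"
    and Hf :: "real ^ 'd ^ 'd" and Hg :: "real ^ 'm ^ 'm"
  assumes S: "sym_mat S" and Hf: "sym_mat Hf" and Hg: "sym_mat Hg"
    and feasible: "A *v xt + B *v yt = c"
    and r: "r = A *v x' + B *v y' - c"
    and \<xi>: "\<xi> = grad fd x' - grad fd x - transpose A *v (u' + S *v r) - Hf *v (x' - x)"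
    and \<zeta>: "\<zeta> = grad gd y' - grad gd y - transpose B *v u' - Hg *v (y' - y)"
    and p': "S *v p' = S *v (A *v (x' - xt)) + (u' - ut)"
    and pp': "p' = p + r"
  shows "(x' - xt) \<bullet> (\<xi> - \<xi>t) + (y' - yt) \<bullet> (\<zeta> - \<zeta>t) + 1/2 * wnorm_sq S r
    = (x' - xt) \<bullet> (- (transpose A *v ut) - \<xi>t) + (y' - yt) \<bullet> (- (transpose B *v ut) - \<zeta>t)
      + (1/2 * wnorm_sq S p + bregman Hf fd xt x + bregman Hg gd yt y)
      - (1/2 * wnorm_sq S p' + bregman Hf fd xt x' + bregman Hg gd yt y')
      - bregman Hf fd x' x - bregman Hg gd y' y"
proof -
  have rd: "r = A *v (x' - xt) + B *v (y' - yt)"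
    using feasible r by (simp add: algebra_simps matrix_vector_mult_diff_distrib)
  \<comment> \<open>Half the increase from \<open>wnorm_sq S p\<close> to
    \<open>wnorm_sq S p'\<close> is \<open>r \<bullet> (S *v p') - 1/2 * wnorm_sq S r\<close>: the
    product cancels the multiplier terms of the subgradients, and the last term is the one on the
    left of the goal.\<close>
  have "wnorm_sq S p' = wnorm_sq S p + 2 * (r \<bullet> (S *v p)) + wnorm_sq S r"
    unfolding pp' by (rule wnorm_sq_add[OF S])
  moreover have "r \<bullet> (S *v p) = r \<bullet> (S *v p') - wnorm_sq S r"
    by (simp add: pp' wnorm_sq_def matrix_vector_right_distrib inner_add_right)
  moreover have "r \<bullet> (S *v p') = (A *v (x' - xt)) \<bullet> (u' + S *v r) + (B *v (y' - yt)) \<bullet> u' - r \<bullet> ut"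
  proof -
    have "r \<bullet> (S *v (A *v (x' - xt))) = (A *v (x' - xt)) \<bullet> (S *v r)"
      by (rule sym_mat_inner[OF S])
    moreover have "r \<bullet> u' = (A *v (x' - xt)) \<bullet> u' + (B *v (y' - yt)) \<bullet> u'"
      by (simp add: rd inner_add_left)
    ultimately show ?thesis
      by (simp add: p' inner_add_right inner_diff_right)
  qed
  moreover have "r \<bullet> ut = (A *v (x' - xt)) \<bullet> ut + (B *v (y' - yt)) \<bullet> ut"
    by (simp add: rd inner_add_left)
  moreover have "(x' - xt) \<bullet> (\<xi> - \<xi>t) = (x' - xt) \<bullet> (grad fd x' - grad fd x)
      - (A *v (x' - xt)) \<bullet> (u' + S *v r) - (x' - xt) \<bullet> (Hf *v (x' - x)) - (x' - xt) \<bullet> \<xi>t"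
    unfolding \<xi> by (simp only: inner_diff_right inner_transpose_mult)
  moreover have "(y' - yt) \<bullet> (\<zeta> - \<zeta>t) = (y' - yt) \<bullet> (grad gd y' - grad gd y)
      - (B *v (y' - yt)) \<bullet> u' - (y' - yt) \<bullet> (Hg *v (y' - y)) - (y' - yt) \<bullet> \<zeta>t"
    unfolding \<zeta> by (simp only: inner_diff_right inner_transpose_mult)
  moreover have "(x' - xt) \<bullet> (- (transpose A *v ut) - \<xi>t) = - ((A *v (x' - xt)) \<bullet> ut) - (x' - xt) \<bullet> \<xi>t"
    by (simp only: inner_diff_right inner_minus_right inner_transpose_mult)
  moreover have "(y' - yt) \<bullet> (- (transpose B *v ut) - \<zeta>t) = - ((B *v (y' - yt)) \<bullet> ut) - (y' - yt) \<bullet> \<zeta>t"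
    by (simp only: inner_diff_right inner_minus_right inner_transpose_mult)
  moreover have "bregman Hf fd xt x' - bregman Hf fd xt x + bregman Hf fd x' x
      = (x' - xt) \<bullet> (Hf *v (x' - x)) - (x' - xt) \<bullet> (grad fd x' - grad fd x)"
    using bregman_three_point[OF Hf, of fd xt x' x] by (simp only: inner_diff_right[of "x' - xt"])
  moreover have "bregman Hg gd yt y' - bregman Hg gd yt y + bregman Hg gd y' y
      = (y' - yt) \<bullet> (Hg *v (y' - y)) - (y' - yt) \<bullet> (grad gd y' - grad gd y)"
    using bregman_three_point[OF Hg, of gd yt y' y] by (simp only: inner_diff_right[of "y' - yt"])
  ultimately show ?thesis
    by linarith
qed

theorem theorem1:
  fixes f fc :: "real ^ 'd \<Rightarrow> ereal" and fd :: "real ^ 'd \<Rightarrow> real"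
    and g gc :: "real ^ 'm \<Rightarrow> ereal" and gd :: "real ^ 'm \<Rightarrow> real"
    and A :: "real ^ 'd ^ 'k" and B :: "real ^ 'm ^ 'k" and c :: "real ^ 'k"
    and S :: "real ^ 'k ^ 'k"
    and \<epsilon> \<epsilon>F \<alpha>f \<alpha>g :: real and cf cg :: ereal
    and xt \<xi>t :: "real ^ 'd" and yt \<zeta>t :: "real ^ 'm" and ut :: "real ^ 'k"
    and Hf :: "real ^ 'd ^ 'd" and Hg :: "real ^ 'm ^ 'm"
    and x0 :: "real ^ 'd" and y0 :: "real ^ 'm" and u0 :: "real ^ 'k"
    and x :: "nat \<Rightarrow> real ^ 'd" and y :: "nat \<Rightarrow> real ^ 'm" and u :: "nat \<Rightarrow> real ^ 'k"
    and T :: nat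
  assumes f: "\<And>v. f v = fc v + ereal (fd v)"
    and fc: "convex_fun fc" "proper_fun fc" "lsc_fun fc"
    and fd: "twice_differentiable fd"
    and g: "\<And>v. g v = gc v + ereal (gd v)"
    and gc: "convex_fun gc" "proper_fun gc" "lsc_fun gc"
    and gd: "twice_differentiable gd"
    and S: "sym_mat S" "posdef S"
    and nonneg: "0 \<le> \<epsilon>" "0 \<le> \<epsilon>F" "0 \<le> \<alpha>f" "0 \<le> \<alpha>g"
    and c_pos: "0 < cf" "0 < cg"
    and feasible: "xt \<in> eff_dom f" "yt \<in> eff_dom g" "A *v xt + B *v yt = c"
    and subgrad: "\<xi>t \<in> subdiff f xt" "\<zeta>t \<in> subdiff g yt"
    and restricted_strong_convexity:
      "\<And>v w \<xi> \<zeta>. \<lbrakk>v \<in> eff_dom f; w \<in> eff_dom g; \<xi> \<in> subdiff f v; \<zeta> \<in> subdiff g w\<rbrakk> \<Longrightarrow>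
         (v - xt) \<bullet> (\<xi> - \<xi>t) + (w - yt) \<bullet> (\<zeta> - \<zeta>t)
         \<ge> \<alpha>f * min_quad_lin cf (norm (v - xt)) + \<alpha>g * min_quad_lin cg (norm (w - yt))
           - 1/2 * wnorm_sq S (A *v v + B *v w - c) - \<epsilon>\<^sup>2"
    and approx_fosp:
      "norm (- (transpose A *v ut) - \<xi>t) \<le> fosp_tol \<alpha>f cf \<epsilon>F"
      "norm (- (transpose B *v ut) - \<zeta>t) \<le> fosp_tol \<alpha>g cg \<epsilon>F"
    and Hf: "sym_mat Hf" "psd Hf" "posdef (Hf + transpose A ** S ** A)"
      "\<And>v. v \<in> eff_dom f \<Longrightarrow> psd (Hf - hess fd v)"
    and Hg: "sym_mat Hg" "psd Hg" "posdef (Hg + transpose B ** S ** B)"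
      "\<And>w. w \<in> eff_dom g \<Longrightarrow> psd (Hg - hess gd w)"
    and init: "x0 \<in> eff_dom f" "y0 \<in> eff_dom g"
      "x 0 = x0" "y 0 = y0" "u 0 = u0"
    and x_step: "\<And>t. x (Suc t) = admm_x fc fd A B c S Hf (x t) (y t) (u t)"
    and y_step: "\<And>t. y (Suc t) = admm_y gc gd A B c S Hg (x (Suc t)) (y t) (u t)"
    and u_step: "\<And>t. u (Suc t) = u t + S *v (A *v x (Suc t) + B *v y (Suc t) - c)"
    and T: "1 \<le> T"
  shows "\<alpha>f * min_quad_lin cf (norm ((1 / real T) *\<^sub>R (\<Sum>t=1..T. x t) - xt))
       + \<alpha>g * min_quad_lin cg (norm ((1 / real T) *\<^sub>R (\<Sum>t=1..T. y t) - yt))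
       \<le> admm_C fc fd gd A B c S Hf Hg \<alpha>f cf xt yt ut x0 y0 u0 / real T
         + 4 * (\<epsilon>\<^sup>2 + \<epsilon>F\<^sup>2)"
proof -
  define r where "r t = A *v x (Suc (Suc t)) + B *v y (Suc t) - c" for t
  define p where "p t = A *v (x (Suc t) - xt) + matrix_inv S *v (u t - ut)" for t
  define \<xi> where "\<xi> t = grad fd (x (Suc (Suc t))) - grad fd (x (Suc t))
    - transpose A *v (u (Suc t) + S *v r t) - Hf *v (x (Suc (Suc t)) - x (Suc t))" for t
  define \<zeta> where "\<zeta> t = grad gd (y (Suc t)) - grad gd (y t)
    - transpose B *v u (Suc t) - Hg *v (y (Suc t) - y t)" for t
  \<comment> \<open>\<open>m\<close> is indexed one step ahead of \<open>n\<close>, matching the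
    pair \<open>x (Suc t)\<close>, \<open>y t\<close> in \<open>V t\<close>.\<close>
  define m where "m t = \<alpha>f * min_quad_lin cf (norm (x (Suc t) - xt))" for t
  define n where "n t = \<alpha>g * min_quad_lin cg (norm (y t - yt))" for t
  define V where "V t = 1/2 * wnorm_sq S (p t) + bregman Hf fd xt (x (Suc t)) + bregman Hg gd yt (y t)" for t
  note Sinv = posdef_matrix_inv[OF S(2)]
  have diff: "fd differentiable (at v)" "gd differentiable (at w)" for v w
    using fd gd by (auto simp: twice_differentiable_def)

  have x_sub: "grad fd (x (Suc t)) - (grad fd (x t) + transpose A *v u t
      + transpose A *v (S *v (A *v x (Suc t) + B *v y t - c)) + Hf *v (x (Suc t) - x t)) \<in> subdiff f (x (Suc t))" for t
    by (rule admm_update[OF fc diff(1) f S(1) Hf(1,3) x_step[unfolded admm_x_def], of _ "B *v y t - c"])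
      (simp add: algebra_simps)
  have y_sub: "grad gd (y (Suc t)) - (grad gd (y t) + transpose B *v u t
      + transpose B *v (S *v (A *v x (Suc t) + B *v y (Suc t) - c)) + Hg *v (y (Suc t) - y t)) \<in> subdiff g (y (Suc t))" for t
    by (rule admm_update[OF gc diff(2) g S(1) Hg(1,3) y_step[unfolded admm_y_def], of _ "A *v x (Suc t) - c"])
      (simp add: algebra_simps)
  \<comment> \<open>The step to \<open>x (Suc (Suc t))\<close> already uses \<open>y (Suc t)\<close>
    and \<open>u (Suc t)\<close>, so its residual is \<open>r t\<close>.\<close>
  have \<xi>: "\<xi> t \<in> subdiff f (x (Suc (Suc t)))" for t
    using x_sub[of "Suc t"] by (simp add: \<xi>_def r_def matrix_vector_right_distrib algebra_simps
      del: transpose_matrix_vector)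
  \<comment> \<open>The residual after the \<open>y\<close>-step is the one in
    \<open>u_step\<close>, which turns the multiplier into \<open>u (Suc t)\<close>.\<close>
  have \<zeta>: "\<zeta> t \<in> subdiff g (y (Suc t))" for t
    using y_sub[of t] by (simp add: \<zeta>_def u_step matrix_vector_right_distrib algebra_simps
      del: transpose_matrix_vector)
  have x_dom: "x (Suc t) \<in> eff_dom f" for t
    using x_sub[of t] by (auto simp: subdiff_def)
  have y_dom: "y t \<in> eff_dom g" for t
    using y_sub[of "t - 1"] init by (cases t) (auto simp: subdiff_def)
  have breg_f: "0 \<le> bregman Hf fd a b" if "a \<in> eff_dom f" "b \<in> eff_dom f" for a b
    by (rule bregman_nonneg[OF fd convex_eff_dom[OF fc(1) f] that Hf(4)])
  have breg_g: "0 \<le> bregman Hg gd a b" if "a \<in> eff_dom g" "b \<in> eff_dom g" for a b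
    by (rule bregman_nonneg[OF gd convex_eff_dom[OF gc(1) g] that Hg(4)])

  \<comment> \<open>Half of the gain pays for the two residuals, each of which also costs
    \<open>\<epsilon>F\<^sup>2 / 2\<close>; \<open>\<epsilon>\<^sup>2\<close> is the slack of
    restricted strong convexity. The divergences between consecutive iterates are dropped as
    nonnegative.\<close>
  have step: "1/2 * (m (Suc t) + n (Suc t)) \<le> V t - V (Suc t) + (\<epsilon>\<^sup>2 + \<epsilon>F\<^sup>2)" for t
  proof -
    have "matrix_inv S *v (u (Suc t) - ut)
        = matrix_inv S *v (u t - ut) + (A *v x (Suc t) + B *v y (Suc t) - c)"
      using Sinv(2)[of "A *v x (Suc t) + B *v y (Suc t) - c"]
      by (simp add: u_step matrix_vector_mult_diff_distrib matrix_vector_right_distrib)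
    then have pp: "p (Suc t) = p t + r t"
      by (simp add: p_def r_def matrix_vector_mult_diff_distrib)
    have Sp: "S *v p (Suc t) = S *v (A *v (x (Suc (Suc t)) - xt)) + (u (Suc t) - ut)"
      by (simp add: p_def matrix_vector_right_distrib Sinv)
    note rsc = restricted_strong_convexity[OF x_dom y_dom \<xi> \<zeta>, of t t, folded r_def]
    note descent = admm_descent[OF S(1) Hf(1) Hg(1) feasible(3) r_def \<xi>_def \<zeta>_def Sp pp, of \<xi>t \<zeta>t]
    note residual =
      fosp_residual[OF c_pos(1) nonneg(3) approx_fosp(1), of "x (Suc (Suc t)) - xt"]
      fosp_residual[OF c_pos(2) nonneg(4) approx_fosp(2), of "y (Suc t) - yt"]
    show ?thesis
      using rsc descent residual breg_f[OF x_dom x_dom, of "Suc t" t] breg_g[OF y_dom y_dom, of "Suc t" t]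
      unfolding V_def m_def n_def by argo
  qed
  have "(\<Sum>t<N. 1/2 * (m (Suc t) + n (Suc t))) \<le> V 0 - V N + real N * (\<epsilon>\<^sup>2 + \<epsilon>F\<^sup>2)" for N
  proof (induction N)
    case (Suc N)
    then show ?case using step[of N] by (simp add: algebra_simps)
  qed simp
  moreover have "0 \<le> V T"
    unfolding V_def using feasible x_dom y_dom
    by (intro add_nonneg_nonneg breg_f breg_g) (simp_all add: wnorm_sq_nonneg S(2))
  ultimately have "(\<Sum>t<T. 1/2 * (m (Suc t) + n (Suc t))) \<le> V 0 + real T * (\<epsilon>\<^sup>2 + \<epsilon>F\<^sup>2)"
    by (smt (verit))
  then have total: "(\<Sum>t<T. m (Suc t)) + (\<Sum>t<T. n (Suc t)) \<le> 2 * V 0 + 2 * real T * (\<epsilon>\<^sup>2 + \<epsilon>F\<^sup>2)"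
    by (simp add: sum.distrib flip: sum_divide_distrib)
  \<comment> \<open>Adding the reverse divergences replaces function values by gradients. The half
    of \<open>wnorm_sq Hf\<close> inside the \<open>M\<close>-norm and the separate half in
    \<open>admm_C1\<close> make up the whole one from \<open>bregman_add_swap\<close>; likewise for
    \<open>Hg\<close>.\<close>
  have V0: "V 0 \<le> admm_C1 fd gd A S Hf Hg xt yt ut (x 1) y0 u0"
  proof -
    have "wnorm_sq S (A *v (xt - x 1) + matrix_inv S *v (ut - u0)) = wnorm_sq S (p 0)"
    proof -
      have "A *v (xt - x 1) + matrix_inv S *v (ut - u0) = - p 0"
        by (simp add: p_def init matrix_vector_mult_diff_distrib)
      then show ?thesis by (simp add: wnorm_sq_minus)
    qed
    moreover have "bregman Hf fd xt (x 1) \<le> wnorm_sq Hf (xt - x 1) - (xt - x 1) \<bullet> (grad fd xt - grad fd (x 1))"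
      using bregman_add_swap[of Hf fd xt "x 1"] breg_f[of "x 1" xt] x_dom[of 0] feasible(1) by simp
    moreover have "bregman Hg gd yt y0 \<le> wnorm_sq Hg (yt - y0) - (yt - y0) \<bullet> (grad gd yt - grad gd y0)"
      using bregman_add_swap[of Hg gd yt y0] breg_g[of y0 yt] init(2) feasible(2) by simp
    ultimately show ?thesis
      unfolding V_def admm_C1_def join_vec_diff wnorm_sq_admm_M[OF S] by (simp add: init add_divide_distrib)
  qed
  \<comment> \<open>The average needs \<open>m 0\<close> to \<open>m (T - 1)\<close>, but
    telescoping controls \<open>m 1\<close> to \<open>m T\<close>; adding the nonnegative
    \<open>m T\<close> leaves \<open>m 0\<close> as the price.\<close>
  have x_sum: "(\<Sum>t=1..T. \<alpha>f * min_quad_lin cf (norm (x t - xt))) \<le> m 0 + (\<Sum>t<T. m (Suc t))"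
  proof -
    have "(\<Sum>t=1..T. \<alpha>f * min_quad_lin cf (norm (x t - xt))) = (\<Sum>t<T. m t)"
      unfolding m_def by (simp add: sum.atLeast1_atMost_eq)
    also have "\<dots> \<le> (\<Sum>t<Suc T. m t)"
      using c_pos nonneg by (simp add: m_def min_quad_lin_nonneg)
    also have "\<dots> = m 0 + (\<Sum>t<T. m (Suc t))"
      by (rule sum.lessThan_Suc_shift)
    finally show ?thesis .
  qed
  have y_sum: "(\<Sum>t=1..T. n t) = (\<Sum>t<T. n (Suc t))"
    by (simp add: sum.atLeast1_atMost_eq)
  have "\<alpha>f * min_quad_lin cf (norm ((1 / real T) *\<^sub>R (\<Sum>t=1..T. x t) - xt))
      \<le> 2 / real T * (\<Sum>t=1..T. \<alpha>f * min_quad_lin cf (norm (x t - xt)))"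
    using mult_left_mono[OF min_quad_lin_average[OF c_pos(1) T, of x xt] nonneg(3)]
    by (simp add: sum_distrib_left mult.left_commute)
  moreover have "\<alpha>g * min_quad_lin cg (norm ((1 / real T) *\<^sub>R (\<Sum>t=1..T. y t) - yt))
      \<le> 2 / real T * (\<Sum>t=1..T. n t)"
    using mult_left_mono[OF min_quad_lin_average[OF c_pos(2) T, of y yt] nonneg(4)]
    by (simp add: n_def sum_distrib_left mult.left_commute)
  ultimately have "\<alpha>f * min_quad_lin cf (norm ((1 / real T) *\<^sub>R (\<Sum>t=1..T. x t) - xt))
       + \<alpha>g * min_quad_lin cg (norm ((1 / real T) *\<^sub>R (\<Sum>t=1..T. y t) - yt))
      \<le> 2 / real T * ((\<Sum>t=1..T. \<alpha>f * min_quad_lin cf (norm (x t - xt))) + (\<Sum>t=1..T. n t))"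
    by (simp add: distrib_left)
  \<comment> \<open>The averaging factor 2 multiplies the 2 from the halved gain, giving 4 for
    \<open>admm_C1\<close> and the errors; \<open>m 0\<close> gets the averaging factor
    only.\<close>
  also have "\<dots> \<le> 2 / real T * (2 * admm_C1 fd gd A S Hf Hg xt yt ut (x 1) y0 u0 + m 0
      + 2 * real T * (\<epsilon>\<^sup>2 + \<epsilon>F\<^sup>2))"
    using total V0 x_sum y_sum by (intro mult_left_mono) auto
  also have "\<dots> = (4 * admm_C1 fd gd A S Hf Hg xt yt ut (x 1) y0 u0 + 2 * m 0) / real T
      + 4 * (\<epsilon>\<^sup>2 + \<epsilon>F\<^sup>2)"
    using T by (simp add: field_simps)
  also have "4 * admm_C1 fd gd A S Hf Hg xt yt ut (x 1) y0 u0 + 2 * m 0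
      = admm_C fc fd gd A B c S Hf Hg \<alpha>f cf xt yt ut x0 y0 u0"
    using x_step[of 0] by (simp add: admm_C_def m_def init Let_def)
  finally show ?thesis .
qed

end
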